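(* Let $\mathcal{C}$ be a dg category over a commutative ring $\Bbbk$ and let $X,Y\in\mathcal{C}$. Let $f:X\to Y$, $g:Y\to X$ be degree $0$ morphisms and $h:X\to X$, $k:Y\to Y$ degree $-1$ morphisms in $\mathcal{C}[[\epsilon]]$. Then $(f,g,h,k)$ is a strong homotopy equivalence $X\simeq Y$ in $\mathcal{C}$ if and only if, setting \[ z_X:=\epsilon(\operatorname{id}_X-g\circ f),\qquad z_Y:=\epsilon(\operatorname{id}_Y-f\circ g), \] the triples $(X,\epsilon h,z_X)$ and $(Y,\epsilon k,z_Y)$ are curved twisted complexes in $\operatorname{cTw}(\mathcal{C}[[\epsilon]])$ and $f:(X,\epsilon h,z_X)\to(Y,\epsilon k,z_Y)$ and $g:(Y,\epsilon k,z_Y)\to(X,\epsilon h,z_X)$ are closed degree zero morphisms in $\operatorname{cTw}(\mathcal{C}[[\epsilon]])$.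
   Context: Dg categories are $\Bbbk$-linear, with $\mathbb{Z}$-graded hom complexes, differential $d$ of degree $+1$, and Leibniz rule $d(f\circ g)=d(f)\circ g+(-1)^{|f|}f\circ d(g)$. $\mathcal{C}[[\epsilon]]$: here $\epsilon$ is a formal variable of degree $2$. $\mathcal{C}[[\epsilon]]$ has the same objects as $\mathcal{C}$; a degree $l$ morphism $X\to Y$ is a formal series $\sum_{i\ge0}f_i\epsilon^i$ with $f_i\in\operatorname{Hom}^{l-2i}_{\mathcal{C}}(X,Y)$; composition and differential are $\epsilon$-linear. Strong homotopy equivalence: a strong homotopy equivalence $X\simeq Y$ in $\mathcal{C}$ consists of morphisms in $\mathcal{C}[[\epsilon]]$: $f:X\to Y$, $g:Y\to X$ of degree $0$, and $h:X\to X$, $k:Y\to Y$ of degree $-1$, such that \[ d(f)=\epsilon(fh-kf),\quad d(g)=\epsilon(gk-hg),\quad d(h)=\operatorname{id}_X-gf-\epsilon h^2,\quad d(k)=\operatorname{id}_Y-fg-\epsilon k^2 . \] Curved twisted complexes: for a dg category $\mathcal{D}$, $\operatorname{cTw}(\mathcal{D})$ is the dg category with objects the triples $(X,\alpha,z_X)$, where $X\in\mathcal{D}$, $z_X\in\operatorname{End}^2_{\mathcal{D}}(X)$ (not necessarily closed), $\alpha\in\operatorname{End}^1_{\mathcal{D}}(X)$ and $d_{\mathcal{D}}(\alpha)+\alpha^2=z_X$. Morphisms $(X,\alpha,z_X)\to(Y,\beta,z_Y)$ are the morphisms $f\in\operatorname{Hom}_{\mathcal{D}}(X,Y)$ with $z_Y\circ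 f=f\circ z_X$, with differential $d_{\operatorname{cTw}(\mathcal{D})}(f)=d_{\mathcal{D}}(f)+\beta\circ f-(-1)^{|f|}f\circ\alpha$. A morphism is closed if its differential is zero. *)

theory Defs
  imports "HOL-Algebra.Module"
begin

text \<open>
  The hom complex from X to Y is the family of k-modules \<open>Hom C X Y n\<close>, n an integer; all morphisms
  are homogeneous. Since a carrier element does not carry its source, target and degree, these are
  arguments of composition and differential: \<open>Cmp C X Y Z m n g f\<close> is g after f for f from X to Y
  of degree n and g from Y to Z of degree m, and \<open>Dif C X Y n f\<close> is the differential of f in
  \<open>Hom C X Y n\<close>. The fields \<open>mult\<close> and \<open>one\<close> of the record type \<open>module\<close> are unused.
\<close>

record ('o, 'k, 'm) dgcat =
  Ob  :: "'o set"
  Hom :: "'o \<Rightarrow> 'o \<Rightarrow> int \<Rightarrow> ('k, 'm) module"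
  Cmp :: "'o \<Rightarrow> 'o \<Rightarrow> 'o \<Rightarrow> int \<Rightarrow> int \<Rightarrow> 'm \<Rightarrow> 'm \<Rightarrow> 'm"
  Idm :: "'o \<Rightarrow> 'm"
  Dif :: "'o \<Rightarrow> 'o \<Rightarrow> int \<Rightarrow> 'm \<Rightarrow> 'm"

text \<open>\<open>ksign M n x\<close> is the sign (-1)^n times x, formed in M.\<close>

definition ksign :: "('a, 'c) ring_scheme \<Rightarrow> int \<Rightarrow> 'a \<Rightarrow> 'a" where
  "ksign M n x = (if even n then x else \<ominus>\<^bsub>M\<^esub> x)"

locale dg_category = cring R for R (structure) +
  fixes C :: "('o, 'a, 'm) dgcat"
  assumes Hom_module:
      "\<lbrakk>X \<in> Ob C; Y \<in> Ob C\<rbrakk> \<Longrightarrow> module R (Hom C X Y n)"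
    and Cmp_closed:
      "\<lbrakk>X \<in> Ob C; Y \<in> Ob C; Z \<in> Ob C; g \<in> carrier (Hom C Y Z m); f \<in> carrier (Hom C X Y n)\<rbrakk>
        \<Longrightarrow> Cmp C X Y Z m n g f \<in> carrier (Hom C X Z (m + n))"
    and Cmp_add_left:
      "\<lbrakk>X \<in> Ob C; Y \<in> Ob C; Z \<in> Ob C; g \<in> carrier (Hom C Y Z m); g' \<in> carrier (Hom C Y Z m);
        f \<in> carrier (Hom C X Y n)\<rbrakk>
        \<Longrightarrow> Cmp C X Y Z m n (g \<oplus>\<^bsub>Hom C Y Z m\<^esub> g') f
            = Cmp C X Y Z m n g f \<oplus>\<^bsub>Hom C X Z (m + n)\<^esub> Cmp C X Y Z m n g' f"
    and Cmp_add_right: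
      "\<lbrakk>X \<in> Ob C; Y \<in> Ob C; Z \<in> Ob C; g \<in> carrier (Hom C Y Z m); f \<in> carrier (Hom C X Y n);
        f' \<in> carrier (Hom C X Y n)\<rbrakk>
        \<Longrightarrow> Cmp C X Y Z m n g (f \<oplus>\<^bsub>Hom C X Y n\<^esub> f')
            = Cmp C X Y Z m n g f \<oplus>\<^bsub>Hom C X Z (m + n)\<^esub> Cmp C X Y Z m n g f'"
    and Cmp_smult_left:
      "\<lbrakk>X \<in> Ob C; Y \<in> Ob C; Z \<in> Ob C; r \<in> carrier R; g \<in> carrier (Hom C Y Z m);
        f \<in> carrier (Hom C X Y n)\<rbrakk>
        \<Longrightarrow> Cmp C X Y Z m n (r \<odot>\<^bsub>Hom C Y Z m\<^esub> g) f
            = r \<odot>\<^bsub>Hom C X Z (m + n)\<^esub> Cmp C X Y Z m n g f"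
    and Cmp_smult_right:
      "\<lbrakk>X \<in> Ob C; Y \<in> Ob C; Z \<in> Ob C; r \<in> carrier R; g \<in> carrier (Hom C Y Z m);
        f \<in> carrier (Hom C X Y n)\<rbrakk>
        \<Longrightarrow> Cmp C X Y Z m n g (r \<odot>\<^bsub>Hom C X Y n\<^esub> f)
            = r \<odot>\<^bsub>Hom C X Z (m + n)\<^esub> Cmp C X Y Z m n g f"
    and Cmp_assoc:
      "\<lbrakk>W \<in> Ob C; X \<in> Ob C; Y \<in> Ob C; Z \<in> Ob C; h \<in> carrier (Hom C Y Z l);
        g \<in> carrier (Hom C X Y m); f \<in> carrier (Hom C W X n)\<rbrakk>
        \<Longrightarrow> Cmp C W X Z (l + m) n (Cmp C X Y Z l m h g) f
            = Cmp C W Y Z l (m + n) h (Cmp C W X Y m n g f)"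
    and Idm_closed:
      "X \<in> Ob C \<Longrightarrow> Idm C X \<in> carrier (Hom C X X 0)"
    and Cmp_Idm_left:
      "\<lbrakk>X \<in> Ob C; Y \<in> Ob C; f \<in> carrier (Hom C X Y n)\<rbrakk> \<Longrightarrow> Cmp C X Y Y 0 n (Idm C Y) f = f"
    and Cmp_Idm_right:
      "\<lbrakk>X \<in> Ob C; Y \<in> Ob C; f \<in> carrier (Hom C X Y n)\<rbrakk> \<Longrightarrow> Cmp C X X Y n 0 f (Idm C X) = f"
    and Dif_closed:
      "\<lbrakk>X \<in> Ob C; Y \<in> Ob C; f \<in> carrier (Hom C X Y n)\<rbrakk>
        \<Longrightarrow> Dif C X Y n f \<in> carrier (Hom C X Y (n + 1))"
    and Dif_add:
      "\<lbrakk>X \<in> Ob C; Y \<in> Ob C; f \<in> carrier (Hom C X Y n); g \<in> carrier (Hom C X Y n)\<rbrakk>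
        \<Longrightarrow> Dif C X Y n (f \<oplus>\<^bsub>Hom C X Y n\<^esub> g)
            = Dif C X Y n f \<oplus>\<^bsub>Hom C X Y (n + 1)\<^esub> Dif C X Y n g"
    and Dif_smult:
      "\<lbrakk>X \<in> Ob C; Y \<in> Ob C; r \<in> carrier R; f \<in> carrier (Hom C X Y n)\<rbrakk>
        \<Longrightarrow> Dif C X Y n (r \<odot>\<^bsub>Hom C X Y n\<^esub> f) = r \<odot>\<^bsub>Hom C X Y (n + 1)\<^esub> Dif C X Y n f"
    and Dif_Dif:
      "\<lbrakk>X \<in> Ob C; Y \<in> Ob C; f \<in> carrier (Hom C X Y n)\<rbrakk>
        \<Longrightarrow> Dif C X Y (n + 1) (Dif C X Y n f) = \<zero>\<^bsub>Hom C X Y (n + 2)\<^esub>"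
    and Leibniz:
      "\<lbrakk>X \<in> Ob C; Y \<in> Ob C; Z \<in> Ob C; f \<in> carrier (Hom C Y Z m); g \<in> carrier (Hom C X Y n)\<rbrakk>
        \<Longrightarrow> Dif C X Z (m + n) (Cmp C X Y Z m n f g)
            = Cmp C X Y Z (m + 1) n (Dif C Y Z m f) g
              \<oplus>\<^bsub>Hom C X Z (m + n + 1)\<^esub>
              ksign (Hom C X Z (m + n + 1)) m (Cmp C X Y Z m (n + 1) f (Dif C X Y n g))"

text \<open>
  \<open>eps_cat C\<close> is C[[\<open>\<epsilon>\<close>]] with \<open>\<epsilon>\<close> of degree 2: a series is the function i \<open>\<mapsto>\<close> coefficient of
  \<open>\<epsilon>^i\<close>, and \<open>eps C X Y l\<close> is multiplication by \<open>\<epsilon>\<close> on morphisms from X to Y of degree l.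
\<close>

definition eps_cat :: "('o, 'k, 'm) dgcat \<Rightarrow> ('o, 'k, nat \<Rightarrow> 'm) dgcat" where
  "eps_cat C =
    \<lparr> Ob = Ob C,
      Hom = (\<lambda>X Y l.
        \<lparr> carrier = {f. \<forall>i. f i \<in> carrier (Hom C X Y (l - 2 * int i))},
          mult = undefined,
          one = undefined,
          zero = (\<lambda>i. \<zero>\<^bsub>Hom C X Y (l - 2 * int i)\<^esub>),
          add = (\<lambda>f g i. f i \<oplus>\<^bsub>Hom C X Y (l - 2 * int i)\<^esub> g i),
          smult = (\<lambda>r f i. r \<odot>\<^bsub>Hom C X Y (l - 2 * int i)\<^esub> f i) \<rparr>),
      Cmp = (\<lambda>X Y Z m n g f i.
        \<Oplus>\<^bsub>Hom C X Z (m + n - 2 * int i)\<^esub> j \<in> {..i}.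
          Cmp C X Y Z (m - 2 * int j) (n - 2 * int (i - j)) (g j) (f (i - j))),
      Idm = (\<lambda>X i. if i = 0 then Idm C X else \<zero>\<^bsub>Hom C X X (- 2 * int i)\<^esub>),
      Dif = (\<lambda>X Y l f i. Dif C X Y (l - 2 * int i) (f i)) \<rparr>"

definition eps :: "('o, 'k, 'm) dgcat \<Rightarrow> 'o \<Rightarrow> 'o \<Rightarrow> int \<Rightarrow> (nat \<Rightarrow> 'm) \<Rightarrow> (nat \<Rightarrow> 'm)" where
  "eps C X Y l f = (\<lambda>i. case i of 0 \<Rightarrow> \<zero>\<^bsub>Hom C X Y (l + 2)\<^esub> | Suc j \<Rightarrow> f j)"

definition strong_homotopy_equivalence ::
  "('o, 'k, 'm) dgcat \<Rightarrow> 'o \<Rightarrow> 'o \<Rightarrow>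
    (nat \<Rightarrow> 'm) \<Rightarrow> (nat \<Rightarrow> 'm) \<Rightarrow> (nat \<Rightarrow> 'm) \<Rightarrow> (nat \<Rightarrow> 'm) \<Rightarrow> bool" where
  "strong_homotopy_equivalence C X Y f g h k \<longleftrightarrow>
    (let E = eps_cat C in
      f \<in> carrier (Hom E X Y 0) \<and> g \<in> carrier (Hom E Y X 0) \<and>
      h \<in> carrier (Hom E X X (-1)) \<and> k \<in> carrier (Hom E Y Y (-1)) \<and>
      Dif E X Y 0 f =
        eps C X Y (-1) (Cmp E X X Y 0 (-1) f h \<ominus>\<^bsub>Hom E X Y (-1)\<^esub> Cmp E X Y Y (-1) 0 k f) \<and>
      Dif E Y X 0 g =
        eps C Y X (-1) (Cmp E Y Y X 0 (-1) g k \<ominus>\<^bsub>Hom E Y X (-1)\<^esub> Cmp E Y X X (-1) 0 h g) \<and>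
      Dif E X X (-1) h =
        Idm E X \<ominus>\<^bsub>Hom E X X 0\<^esub> Cmp E X Y X 0 0 g f
          \<ominus>\<^bsub>Hom E X X 0\<^esub> eps C X X (-2) (Cmp E X X X (-1) (-1) h h) \<and>
      Dif E Y Y (-1) k =
        Idm E Y \<ominus>\<^bsub>Hom E Y Y 0\<^esub> Cmp E Y X Y 0 0 f g
          \<ominus>\<^bsub>Hom E Y Y 0\<^esub> eps C Y Y (-2) (Cmp E Y Y Y (-1) (-1) k k))"

definition cTw :: "('o, 'k, 'm) dgcat \<Rightarrow> ('o \<times> 'm \<times> 'm, 'k, 'm) dgcat" where
  "cTw D =
    \<lparr> Ob = {(X, \<alpha>, z). X \<in> Ob D \<and> z \<in> carrier (Hom D X X 2) \<and> \<alpha> \<in> carrier (Hom D X X 1) \<and>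
              Dif D X X 1 \<alpha> \<oplus>\<^bsub>Hom D X X 2\<^esub> Cmp D X X X 1 1 \<alpha> \<alpha> = z},
      Hom = (\<lambda>(X, \<alpha>, z) (Y, \<beta>, w) n.
        (Hom D X Y n)\<lparr>carrier :=
          {f \<in> carrier (Hom D X Y n). Cmp D X Y Y 2 n w f = Cmp D X X Y n 2 f z}\<rparr>),
      Cmp = (\<lambda>(X, _) (Y, _) (Z, _). Cmp D X Y Z),
      Idm = (\<lambda>(X, _). Idm D X),
      Dif = (\<lambda>(X, \<alpha>, z) (Y, \<beta>, w) n f.
        Dif D X Y n f \<oplus>\<^bsub>Hom D X Y (n + 1)\<^esub> Cmp D X Y Y 1 n \<beta> f
          \<ominus>\<^bsub>Hom D X Y (n + 1)\<^esub> ksign (Hom D X Y (n + 1)) n (Cmp D X X Y n 1 f \<alpha>)) \<rparr>"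

definition closed_morphism ::
  "('o, 'k, 'm) dgcat \<Rightarrow> 'o \<Rightarrow> 'o \<Rightarrow> int \<Rightarrow> 'm \<Rightarrow> bool" where
  "closed_morphism D X Y n f \<longleftrightarrow>
    f \<in> carrier (Hom D X Y n) \<and> Dif D X Y n f = \<zero>\<^bsub>Hom D X Y (n + 1)\<^esub>"

end

theory Submission
  imports Defs
begin

text \<open>
  Each conjunct of a strong homotopy equivalence matches one condition on curved twisted complexes.
  Multiplication by \<open>\<epsilon>\<close> is injective and commutes with composition and differential, so the
  Maurer-Cartan equation for \<open>\<epsilon>h\<close> is \<open>\<epsilon>\<close> times the equation for \<open>d(h)\<close>. Closedness of f in cTw reads
  \<open>d(f) + \<epsilon>kf - \<epsilon>fh = 0\<close>, the equation for \<open>d(f)\<close>. That f intertwines the curvatures is automatic from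
  \<open>(1 - fg)f = f(1 - gf)\<close>.
\<close>

section \<open>Sums over triangles, subtraction and additive maps in abelian groups\<close>

context abelian_monoid
begin

text \<open>Both sides run over the triangle \<open>a + b \<le> n\<close>, on the left by
  antidiagonals \<open>a + b = j\<close> and on the right by rows with \<open>a\<close> fixed. In
  the step from \<open>n\<close> to \<open>Suc n\<close> both sides gain the antidiagonal
  \<open>a + b = Suc n\<close>. This regrouping is the combinatorial content of associativity for
  products of power series.\<close>

lemma finsum_triangle:
  assumes "\<And>a b. a + b \<le> n \<Longrightarrow> F a b \<in> carrier G"
  shows "(\<Oplus>j\<in>{..n}. \<Oplus>a\<in>{..j}. F a (j - a)) = (\<Oplus>a\<in>{..n}. \<Oplus>b\<in>{..n - a}. F a (b::nat))"
  using assms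
proof (induction n)
  case 0
  then show ?case by (simp add: Pi_def)
next
  case (Suc n)
  have IH: "(\<Oplus>j\<in>{..n}. \<Oplus>a\<in>{..j}. F a (j - a)) = (\<Oplus>a\<in>{..n}. \<Oplus>b\<in>{..n - a}. F a b)"
    using Suc by simp
  \<comment> \<open>Each old row meets the new antidiagonal in exactly one entry.\<close>
  have row: "(\<Oplus>b\<in>{..Suc n - a}. F a b) = F a (Suc n - a) \<oplus> (\<Oplus>b\<in>{..n - a}. F a b)"
    if "a \<le> n" for a
    using that Suc.prems by (simp add: Suc_diff_le Pi_def)
  have "(\<Oplus>a\<in>{..n}. \<Oplus>b\<in>{..Suc n - a}. F a b)
      = (\<Oplus>a\<in>{..n}. F a (Suc n - a) \<oplus> (\<Oplus>b\<in>{..n - a}. F a b))"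
    by (rule finsum_cong') (auto simp: row Suc.prems intro!: finsum_closed a_closed)
  also have "\<dots> = (\<Oplus>a\<in>{..n}. F a (Suc n - a)) \<oplus> (\<Oplus>a\<in>{..n}. \<Oplus>b\<in>{..n - a}. F a b)"
    by (rule finsum_addf) (auto simp: Suc.prems intro!: finsum_closed)
  finally have rows: "(\<Oplus>a\<in>{..n}. \<Oplus>b\<in>{..Suc n - a}. F a b)
      = (\<Oplus>a\<in>{..n}. F a (Suc n - a)) \<oplus> (\<Oplus>a\<in>{..n}. \<Oplus>b\<in>{..n - a}. F a b)" .
  have L: "(\<Oplus>j\<in>{..Suc n}. \<Oplus>a\<in>{..j}. F a (j - a))
      = (\<Oplus>a\<in>{..Suc n}. F a (Suc n - a)) \<oplus> (\<Oplus>j\<in>{..n}. \<Oplus>a\<in>{..j}. F a (j - a))"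
    by (rule finsum_Suc) (auto simp: Suc.prems intro!: finsum_closed)
  \<comment> \<open>The entry \<open>F (Suc n) 0\<close> is split off because on the right it forms
    a row of its own.\<close>
  have L': "(\<Oplus>a\<in>{..Suc n}. F a (Suc n - a)) = F (Suc n) 0 \<oplus> (\<Oplus>a\<in>{..n}. F a (Suc n - a))"
    by (subst finsum_Suc) (auto simp: Suc.prems)
  have "(\<Oplus>a\<in>{..Suc n}. \<Oplus>b\<in>{..Suc n - a}. F a b)
      = (\<Oplus>b\<in>{..Suc n - Suc n}. F (Suc n) b) \<oplus> (\<Oplus>a\<in>{..n}. \<Oplus>b\<in>{..Suc n - a}. F a b)"
    by (rule finsum_Suc) (auto simp: Suc.prems intro!: finsum_closed)
  also have "(\<Oplus>b\<in>{..Suc n - Suc n}. F (Suc n) b) = F (Suc n) 0"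
    using Suc.prems by (simp add: Pi_def)
  finally have R: "(\<Oplus>a\<in>{..Suc n}. \<Oplus>b\<in>{..Suc n - a}. F a b)
      = F (Suc n) 0 \<oplus> (\<Oplus>a\<in>{..n}. \<Oplus>b\<in>{..Suc n - a}. F a b)" .
  show ?case
    unfolding L L' R rows IH
    by (rule a_assoc) (auto simp: Suc.prems intro!: finsum_closed)
qed

end

context abelian_group
begin

lemma add_eq_iff_eq_minus:
  assumes "x \<in> carrier G" "y \<in> carrier G" "z \<in> carrier G"
  shows "x \<oplus> y = z \<longleftrightarrow> x = z \<ominus> y"
  using assms add.inv_solve_right[of x z y] by (auto simp: a_minus_def)

text \<open>The left side has the shape of the vanishing of a \<open>cTw\<close> differential in
  degree 0; the right side isolates the original differential.\<close>

lemma add_minus_eq_zero_iff: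
  assumes "x \<in> carrier G" "y \<in> carrier G" "z \<in> carrier G"
  shows "x \<oplus> y \<ominus> z = \<zero> \<longleftrightarrow> x = z \<ominus> y"
  using assms add.inv_solve_right[of \<zero> "x \<oplus> y" z] add_eq_iff_eq_minus[of x y z]
  by (auto simp: a_minus_def)

end

text \<open>Composition in either slot, the differential and multiplication by \<epsilon> are all
  additive maps between hom groups. The locale derives their compatibility with zero, differences
  and finite sums once for all of them.\<close>

locale additive_map = G: abelian_group G + H: abelian_group H
  for G (structure) and H (structure) +
  fixes \<phi>
  assumes closed: "x \<in> carrier G \<Longrightarrow> \<phi> x \<in> carrier H"
    and add: "\<lbrakk>x \<in> carrier G; y \<in> carrier G\<rbrakk> \<Longrightarrow> \<phi> (x \<oplus>\<^bsub>G\<^esub> y) = \<phi> x \<oplus>\<^bsub>H\<^esub> \<phi> y"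
begin

lemma zero: "\<phi> \<zero>\<^bsub>G\<^esub> = \<zero>\<^bsub>H\<^esub>"
  by (metis G.zero_closed G.l_zero H.add.r_cancel_one' add closed)

lemma minus:
  assumes "x \<in> carrier G" "y \<in> carrier G"
  shows "\<phi> (x \<ominus>\<^bsub>G\<^esub> y) = \<phi> x \<ominus>\<^bsub>H\<^esub> \<phi> y"
proof -
  \<comment> \<open>The image of the difference is characterized by what it gives when
    \<open>\<phi> y\<close> is added back, so negatives need no separate treatment.\<close>
  have "\<phi> (x \<ominus>\<^bsub>G\<^esub> y) \<oplus>\<^bsub>H\<^esub> \<phi> y = \<phi> x"
    using assms G.add_eq_iff_eq_minus[of "x \<ominus>\<^bsub>G\<^esub> y" y x] by (simp flip: add)
  with assms show ?thesis
    using H.add_eq_iff_eq_minus by (simp add: closed)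
qed

lemma finsum:
  assumes "\<And>i. i \<in> A \<Longrightarrow> f i \<in> carrier G"
  shows "\<phi> (\<Oplus>\<^bsub>G\<^esub>i\<in>A. f i) = (\<Oplus>\<^bsub>H\<^esub>i\<in>A. \<phi> (f i))"
  using assms
proof (induction A rule: infinite_finite_induct)
  case (insert a A)
  then show ?case
    by (simp add: closed add Pi_def)
\<comment> \<open>Over an infinite index set both sums are zero by convention, so that case reduces
  to \<open>\<phi>\<close> preserving zero, just as the empty one does.\<close>
qed (auto simp: zero)

end

section \<open>Additivity of composition and differential in the given dg category\<close>

context dg_category
begin

lemma Hom_abelian_group:
  "\<lbrakk>X \<in> Ob C; Y \<in> Ob C\<rbrakk> \<Longrightarrow> abelian_group (Hom C X Y n)"
  using Hom_module module.axioms(2) by blast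

text \<open>
  Degrees such as \<open>m - 2 * int j + (n - 2 * int (i - j))\<close> and \<open>m + n - 2 * int i\<close> agree only provably,
  not syntactically; hence the premises of the form \<open>p = m + n\<close>.
\<close>

lemma Cmp_closed':
  "\<lbrakk>X \<in> Ob C; Y \<in> Ob C; Z \<in> Ob C; g \<in> carrier (Hom C Y Z m); f \<in> carrier (Hom C X Y n); p = m + n\<rbrakk>
    \<Longrightarrow> Cmp C X Y Z m n g f \<in> carrier (Hom C X Z p)"
  using Cmp_closed by simp

lemma Cmp_assoc':
  assumes "W \<in> Ob C" "X \<in> Ob C" "Y \<in> Ob C" "Z \<in> Ob C" "h \<in> carrier (Hom C Y Z l)"
    "g \<in> carrier (Hom C X Y m)" "f \<in> carrier (Hom C W X n)" "p = l + m" "q = m + n"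
  shows "Cmp C W X Z p n (Cmp C X Y Z l m h g) f = Cmp C W Y Z l q h (Cmp C W X Y m n g f)"
  using assms Cmp_assoc by simp

lemma additive_map_Cmp_left:
  assumes "X \<in> Ob C" "Y \<in> Ob C" "Z \<in> Ob C" "f \<in> carrier (Hom C X Y n)" "p = m + n"
  shows "additive_map (Hom C Y Z m) (Hom C X Z p) (\<lambda>g. Cmp C X Y Z m n g f)"
  unfolding additive_map_def additive_map_axioms_def
  using assms by (auto simp: Hom_abelian_group Cmp_closed Cmp_add_left)

lemma additive_map_Cmp_right:
  assumes "X \<in> Ob C" "Y \<in> Ob C" "Z \<in> Ob C" "g \<in> carrier (Hom C Y Z m)" "p = m + n"
  shows "additive_map (Hom C X Y n) (Hom C X Z p) (Cmp C X Y Z m n g)"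
  unfolding additive_map_def additive_map_axioms_def
  using assms by (auto simp: Hom_abelian_group Cmp_closed Cmp_add_right)

lemma Cmp_zero_left:
  assumes "X \<in> Ob C" "Y \<in> Ob C" "Z \<in> Ob C" "f \<in> carrier (Hom C X Y n)" "p = m + n"
  shows "Cmp C X Y Z m n \<zero>\<^bsub>Hom C Y Z m\<^esub> f = \<zero>\<^bsub>Hom C X Z p\<^esub>"
  using additive_map.zero[OF additive_map_Cmp_left[OF assms]] .

lemma Cmp_zero_right:
  assumes "X \<in> Ob C" "Y \<in> Ob C" "Z \<in> Ob C" "g \<in> carrier (Hom C Y Z m)" "p = m + n"
  shows "Cmp C X Y Z m n g \<zero>\<^bsub>Hom C X Y n\<^esub> = \<zero>\<^bsub>Hom C X Z p\<^esub>"
  using additive_map.zero[OF additive_map_Cmp_right[OF assms]] .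

lemma additive_map_Dif:
  assumes "X \<in> Ob C" "Y \<in> Ob C"
  shows "additive_map (Hom C X Y n) (Hom C X Y (n + 1)) (Dif C X Y n)"
  unfolding additive_map_def additive_map_axioms_def
  using assms by (auto simp: Hom_abelian_group Dif_closed Dif_add)

section \<open>The category of power series: hom groups, composition, associativity and
  identities\<close>

abbreviation E where "E \<equiv> eps_cat C"

lemma Ob_E [simp]: "Ob E = Ob C"
  by (simp add: eps_cat_def)

lemma carrier_E: "carrier (Hom E X Y l) = {f. \<forall>i. f i \<in> carrier (Hom C X Y (l - 2 * int i))}"
  by (simp add: eps_cat_def)

lemma coeff_closed:
  "\<lbrakk>f \<in> carrier (Hom E X Y l); n = l - 2 * int i\<rbrakk> \<Longrightarrow> f i \<in> carrier (Hom C X Y n)"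
  by (simp add: carrier_E)

lemma add_E: "f \<oplus>\<^bsub>Hom E X Y l\<^esub> g = (\<lambda>i. f i \<oplus>\<^bsub>Hom C X Y (l - 2 * int i)\<^esub> g i)"
  by (simp add: eps_cat_def)

lemma zero_E: "\<zero>\<^bsub>Hom E X Y l\<^esub> = (\<lambda>i. \<zero>\<^bsub>Hom C X Y (l - 2 * int i)\<^esub>)"
  by (simp add: eps_cat_def)

lemma Cmp_E: "Cmp E X Y Z m n g f i = (\<Oplus>\<^bsub>Hom C X Z (m + n - 2 * int i)\<^esub> j \<in> {..i}.
    Cmp C X Y Z (m - 2 * int j) (n - 2 * int (i - j)) (g j) (f (i - j)))"
  by (simp add: eps_cat_def)

lemma Dif_E: "Dif E X Y l f i = Dif C X Y (l - 2 * int i) (f i)"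
  by (simp add: eps_cat_def)

lemma Idm_E: "Idm E X i = (if i = 0 then Idm C X else \<zero>\<^bsub>Hom C X X (- 2 * int i)\<^esub>)"
  by (simp add: eps_cat_def)

lemma E_abelian_group:
  assumes "X \<in> Ob C" "Y \<in> Ob C"
  shows "abelian_group (Hom E X Y l)"
proof -
  interpret abelian_group "Hom C X Y d" for d
    using assms by (rule Hom_abelian_group)
  show ?thesis
  proof (rule abelian_groupI)
    fix x assume x: "x \<in> carrier (Hom E X Y l)"
    show "\<exists>y\<in>carrier (Hom E X Y l). y \<oplus>\<^bsub>Hom E X Y l\<^esub> x = \<zero>\<^bsub>Hom E X Y l\<^esub>"
      using x by (intro bexI[of _ "\<lambda>i. \<ominus>\<^bsub>Hom C X Y (l - 2 * int i)\<^esub> x i"])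
        (auto simp: carrier_E add_E zero_E l_neg)
  qed (auto simp: carrier_E add_E zero_E a_ac)
qed

text \<open>The degrees of the two factors add up to \<open>m + n - 2 * int i\<close> because
  \<open>j + (i - j) = i\<close>, which for truncated subtraction relies on
  \<open>j \<le> i\<close>.\<close>

lemma Cmp_E_summand_closed:
  assumes "X \<in> Ob C" "Y \<in> Ob C" "Z \<in> Ob C" "g \<in> carrier (Hom E Y Z m)" "f \<in> carrier (Hom E X Y n)"
    and "j \<le> i" "p = m + n - 2 * int i"
  shows "Cmp C X Y Z (m - 2 * int j) (n - 2 * int (i - j)) (g j) (f (i - j)) \<in> carrier (Hom C X Z p)"
  using assms by (intro Cmp_closed') (auto intro!: coeff_closed)

lemma Cmp_E_closed:
  assumes "X \<in> Ob C" "Y \<in> Ob C" "Z \<in> Ob C" "g \<in> carrier (Hom E Y Z m)" "f \<in> carrier (Hom E X Y n)"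
    and "p = m + n"
  shows "Cmp E X Y Z m n g f \<in> carrier (Hom E X Z p)"
proof -
  interpret abelian_group "Hom C X Z d" for d
    using assms(1,3) by (rule Hom_abelian_group)
  show ?thesis
    using assms by (auto simp: carrier_E Cmp_E intro!: finsum_closed Cmp_E_summand_closed)
qed

text \<open>Every summand of the product coefficient is additive in \<open>g\<close>, and a finite
  sum of sums splits into two sums.\<close>

lemma additive_map_Cmp_E_left:
  assumes "X \<in> Ob C" "Y \<in> Ob C" "Z \<in> Ob C" and f: "f \<in> carrier (Hom E X Y n)" and p: "p = m + n"
  shows "additive_map (Hom E Y Z m) (Hom E X Z p) (\<lambda>g. Cmp E X Y Z m n g f)"
  unfolding additive_map_def additive_map_axioms_def
proof (intro conjI allI impI E_abelian_group assms Cmp_E_closed)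
  interpret abelian_group "Hom C X Z d" for d
    using assms(1,3) by (rule Hom_abelian_group)
  fix g g' assume g: "g \<in> carrier (Hom E Y Z m)" "g' \<in> carrier (Hom E Y Z m)"
  show "Cmp E X Y Z m n (g \<oplus>\<^bsub>Hom E Y Z m\<^esub> g') f
      = Cmp E X Y Z m n g f \<oplus>\<^bsub>Hom E X Z p\<^esub> Cmp E X Y Z m n g' f"
  proof
    fix i
    let ?H = "Hom C X Z (m + n - 2 * int i)"
    let ?c = "\<lambda>g j. Cmp C X Y Z (m - 2 * int j) (n - 2 * int (i - j)) (g j) (f (i - j))"
    have "?c (g \<oplus>\<^bsub>Hom E Y Z m\<^esub> g') j = ?c g j \<oplus>\<^bsub>?H\<^esub> ?c g' j" if "j \<le> i" for j
      unfolding add_E using assms(1-3) that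
      by (intro additive_map.add[OF additive_map_Cmp_left, of X Y Z] coeff_closed[OF f] coeff_closed[OF g(1)] coeff_closed[OF g(2)]) auto
    then have "finsum ?H (?c (g \<oplus>\<^bsub>Hom E Y Z m\<^esub> g')) {..i} = (\<Oplus>\<^bsub>?H\<^esub>j\<in>{..i}. ?c g j \<oplus>\<^bsub>?H\<^esub> ?c g' j)"
      using assms g by (intro finsum_cong') (auto intro!: a_closed Cmp_E_summand_closed)
    also have "\<dots> = finsum ?H (?c g) {..i} \<oplus>\<^bsub>?H\<^esub> finsum ?H (?c g') {..i}"
      using assms g by (intro finsum_addf) (auto intro!: Cmp_E_summand_closed)
    finally show "Cmp E X Y Z m n (g \<oplus>\<^bsub>Hom E Y Z m\<^esub> g') f i
        = (Cmp E X Y Z m n g f \<oplus>\<^bsub>Hom E X Z p\<^esub> Cmp E X Y Z m n g' f) i"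
      unfolding Cmp_E add_E[where X = X and Y = Z] p .
  qed
qed

lemma additive_map_Cmp_E_right:
  assumes "X \<in> Ob C" "Y \<in> Ob C" "Z \<in> Ob C" and g: "g \<in> carrier (Hom E Y Z m)" and p: "p = m + n"
  shows "additive_map (Hom E X Y n) (Hom E X Z p) (Cmp E X Y Z m n g)"
  unfolding additive_map_def additive_map_axioms_def
proof (intro conjI allI impI E_abelian_group assms Cmp_E_closed)
  interpret abelian_group "Hom C X Z d" for d
    using assms(1,3) by (rule Hom_abelian_group)
  fix f f' assume f: "f \<in> carrier (Hom E X Y n)" "f' \<in> carrier (Hom E X Y n)"
  show "Cmp E X Y Z m n g (f \<oplus>\<^bsub>Hom E X Y n\<^esub> f')
      = Cmp E X Y Z m n g f \<oplus>\<^bsub>Hom E X Z p\<^esub> Cmp E X Y Z m n g f'"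
  proof
    fix i
    let ?H = "Hom C X Z (m + n - 2 * int i)"
    let ?c = "\<lambda>f j. Cmp C X Y Z (m - 2 * int j) (n - 2 * int (i - j)) (g j) (f (i - j))"
    have "?c (f \<oplus>\<^bsub>Hom E X Y n\<^esub> f') j = ?c f j \<oplus>\<^bsub>?H\<^esub> ?c f' j" if "j \<le> i" for j
      unfolding add_E using assms(1-3) that
      by (intro additive_map.add[OF additive_map_Cmp_right, of X Y Z] coeff_closed[OF g] coeff_closed[OF f(1)] coeff_closed[OF f(2)]) auto
    then have "finsum ?H (?c (f \<oplus>\<^bsub>Hom E X Y n\<^esub> f')) {..i} = (\<Oplus>\<^bsub>?H\<^esub>j\<in>{..i}. ?c f j \<oplus>\<^bsub>?H\<^esub> ?c f' j)"
      using assms f by (intro finsum_cong') (auto intro!: a_closed Cmp_E_summand_closed)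
    also have "\<dots> = finsum ?H (?c f) {..i} \<oplus>\<^bsub>?H\<^esub> finsum ?H (?c f') {..i}"
      using assms f by (intro finsum_addf) (auto intro!: Cmp_E_summand_closed)
    finally show "Cmp E X Y Z m n g (f \<oplus>\<^bsub>Hom E X Y n\<^esub> f') i
        = (Cmp E X Y Z m n g f \<oplus>\<^bsub>Hom E X Z p\<^esub> Cmp E X Y Z m n g f') i"
      unfolding Cmp_E add_E[where X = X and Y = Z] p .
  qed
qed

text \<open>At coefficient \<open>i\<close> both sides are sums of threefold composites over all
  splittings of \<open>i\<close> into three indices. They differ in the order of summation, settled
  by \<open>finsum_triangle\<close>, and in bracketing, settled by associativity in
  \<open>C\<close>.\<close>

lemma Cmp_E_assoc:
  assumes ob: "W \<in> Ob C" "X \<in> Ob C" "Y \<in> Ob C" "Z \<in> Ob C"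
    and h: "h \<in> carrier (Hom E Y Z l)" and g: "g \<in> carrier (Hom E X Y m)"
    and f: "f \<in> carrier (Hom E W X n)"
  shows "Cmp E W X Z (l + m) n (Cmp E X Y Z l m h g) f
    = Cmp E W Y Z l (m + n) h (Cmp E W X Y m n g f)"
proof
  fix i
  interpret abelian_group "Hom C W Z d" for d
    using ob(1,4) by (rule Hom_abelian_group)
  let ?H = "Hom C W Z (l + m + n - 2 * int i)"
  \<comment> \<open>\<open>F a b\<close> is the contribution of coefficient \<open>a\<close> of
    \<open>h\<close> and coefficient \<open>b\<close> of \<open>g\<close>; the coefficient of
    \<open>f\<close> takes the remaining index.\<close>
  define F where "F a b = Cmp C W Y Z (l - 2 * int a) (m + n - 2 * int (i - a)) (h a)
      (Cmp C W X Y (m - 2 * int b) (n - 2 * int (i - a - b)) (g b) (f (i - a - b)))" for a b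
  have F_closed: "F a b \<in> carrier ?H" if "a + b \<le> i" for a b
    unfolding F_def using ob that
    by (intro Cmp_closed' coeff_closed[OF f] coeff_closed[OF g] coeff_closed[OF h]) auto
  \<comment> \<open>Composition with a fixed coefficient of \<open>f\<close> is additive, so it
    moves inside the inner sum. There the index of \<open>g\<close> is \<open>j - a\<close>.\<close>
  have left: "Cmp C W X Z (l + m - 2 * int j) (n - 2 * int (i - j)) (Cmp E X Y Z l m h g j) (f (i - j))
      = (\<Oplus>\<^bsub>?H\<^esub>a\<in>{..j}. F a (j - a))" if "j \<le> i" for j
  proof -
    interpret additive_map "Hom C X Z (l + m - 2 * int j)" ?H
      "\<lambda>u. Cmp C W X Z (l + m - 2 * int j) (n - 2 * int (i - j)) u (f (i - j))"
      using ob f that by (intro additive_map_Cmp_left) (auto intro!: coeff_closed)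
    have "Cmp C W X Z (l + m - 2 * int j) (n - 2 * int (i - j)) (Cmp E X Y Z l m h g j) (f (i - j))
        = (\<Oplus>\<^bsub>?H\<^esub>a\<in>{..j}. Cmp C W X Z (l + m - 2 * int j) (n - 2 * int (i - j))
            (Cmp C X Y Z (l - 2 * int a) (m - 2 * int (j - a)) (h a) (g (j - a))) (f (i - j)))"
      unfolding Cmp_E using ob h g by (intro finsum Cmp_E_summand_closed) auto
    also have "\<dots> = (\<Oplus>\<^bsub>?H\<^esub>a\<in>{..j}. F a (j - a))"
    proof (rule finsum_cong')
      fix a assume "a \<in> {..j}"
      with that have "i - a - (j - a) = i - j" by simp
      with ob that \<open>a \<in> {..j}\<close> show "Cmp C W X Z (l + m - 2 * int j) (n - 2 * int (i - j))
          (Cmp C X Y Z (l - 2 * int a) (m - 2 * int (j - a)) (h a) (g (j - a))) (f (i - j)) = F a (j - a)"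
        unfolding F_def by (simp only:)
          (intro Cmp_assoc' coeff_closed[OF h] coeff_closed[OF g] coeff_closed[OF f], auto)
    qed (use that in \<open>auto intro: F_closed\<close>)
    finally show ?thesis .
  qed
  have right: "Cmp C W Y Z (l - 2 * int a) (m + n - 2 * int (i - a)) (h a) (Cmp E W X Y m n g f (i - a))
      = (\<Oplus>\<^bsub>?H\<^esub>b\<in>{..i - a}. F a b)" if "a \<le> i" for a
  proof -
    interpret additive_map "Hom C W Y (m + n - 2 * int (i - a))" ?H
      "Cmp C W Y Z (l - 2 * int a) (m + n - 2 * int (i - a)) (h a)"
      using ob h that by (intro additive_map_Cmp_right) (auto intro!: coeff_closed)
    show ?thesis
      unfolding Cmp_E F_def using ob f g by (intro finsum Cmp_E_summand_closed) auto
  qed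
  have "Cmp E W X Z (l + m) n (Cmp E X Y Z l m h g) f i = (\<Oplus>\<^bsub>?H\<^esub>j\<in>{..i}. \<Oplus>\<^bsub>?H\<^esub>a\<in>{..j}. F a (j - a))"
    unfolding Cmp_E[of W X Z]
    by (rule finsum_cong') (auto simp: left simp del: of_nat_diff intro!: finsum_closed F_closed)
  also have "\<dots> = (\<Oplus>\<^bsub>?H\<^esub>a\<in>{..i}. \<Oplus>\<^bsub>?H\<^esub>b\<in>{..i - a}. F a b)"
    by (rule finsum_triangle) (rule F_closed)
  also have "\<dots> = Cmp E W Y Z l (m + n) h (Cmp E W X Y m n g f) i"
    \<comment> \<open>This side lives in degree \<open>l + (m + n)\<close>; rebracketing the
      integers identifies its hom module with \<open>?H\<close>.\<close>
    unfolding Cmp_E[of W Y Z] add.assoc[symmetric]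
    by (rule finsum_cong'[symmetric])
      (auto simp: right simp del: of_nat_diff intro!: finsum_closed F_closed)
  finally show "Cmp E W X Z (l + m) n (Cmp E X Y Z l m h g) f i
      = Cmp E W Y Z l (m + n) h (Cmp E W X Y m n g f) i" .
qed

lemma Idm_E_closed: "X \<in> Ob C \<Longrightarrow> Idm E X \<in> carrier (Hom E X X 0)"
  using abelian_group.axioms(1)[OF Hom_abelian_group]
  by (auto simp: carrier_E Idm_E Idm_closed intro!: abelian_monoid.zero_closed)

text \<open>The identity series is concentrated at index 0, so only the summand with
  \<open>j = 0\<close> survives.\<close>

lemma Cmp_E_Idm_left:
  assumes ob: "X \<in> Ob C" "Y \<in> Ob C" and f: "f \<in> carrier (Hom E X Y n)"
  shows "Cmp E X Y Y 0 n (Idm E Y) f = f"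
proof
  fix i
  interpret abelian_group "Hom C X Y d" for d
    using ob by (rule Hom_abelian_group)
  have "Cmp C X Y Y (0 - 2 * int j) (n - 2 * int (i - j)) (Idm E Y j) (f (i - j))
      = (if 0 = j then f i else \<zero>\<^bsub>Hom C X Y (n - 2 * int i)\<^esub>)" if "j \<le> i" for j
  proof (cases j)
    case 0
    then show ?thesis
      using ob coeff_closed[OF f refl, of i] by (simp add: Idm_E Cmp_Idm_left)
  next
    case (Suc j')
    have "Cmp C X Y Y (- 2 * int j) (n - 2 * int (i - j)) \<zero>\<^bsub>Hom C Y Y (- 2 * int j)\<^esub> (f (i - j))
        = \<zero>\<^bsub>Hom C X Y (n - 2 * int i)\<^esub>"
      using ob that by (intro Cmp_zero_left coeff_closed[OF f]) auto
    with Suc show ?thesis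
      by (simp add: Idm_E)
  qed
  then have "Cmp E X Y Y 0 n (Idm E Y) f i
      = (\<Oplus>\<^bsub>Hom C X Y (n - 2 * int i)\<^esub>j\<in>{..i}. if 0 = j then f i else \<zero>\<^bsub>Hom C X Y (n - 2 * int i)\<^esub>)"
    unfolding Cmp_E using f by (simp only: add_0) (rule finsum_cong', auto simp: carrier_E)
  also have "\<dots> = f i"
    using f by (intro finsum_singleton) (auto simp: carrier_E)
  finally show "Cmp E X Y Y 0 n (Idm E Y) f i = f i" .
qed

text \<open>Here the identity series carries the index \<open>i - j\<close>, so the surviving
  summand is the last one, \<open>j = i\<close>.\<close>

lemma Cmp_E_Idm_right:
  assumes ob: "X \<in> Ob C" "Y \<in> Ob C" and f: "f \<in> carrier (Hom E X Y n)"
  shows "Cmp E X X Y n 0 f (Idm E X) = f"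
proof
  fix i
  interpret abelian_group "Hom C X Y d" for d
    using ob by (rule Hom_abelian_group)
  have "Cmp C X X Y (n - 2 * int j) (0 - 2 * int (i - j)) (f j) (Idm E X (i - j))
      = (if i = j then f i else \<zero>\<^bsub>Hom C X Y (n - 2 * int i)\<^esub>)" if "j \<le> i" for j
  proof (cases "i = j")
    case True
    then show ?thesis
      using ob coeff_closed[OF f refl, of i] by (simp add: Idm_E Cmp_Idm_right)
  next
    case False
    have "Cmp C X X Y (n - 2 * int j) (- 2 * int (i - j)) (f j) \<zero>\<^bsub>Hom C X X (- 2 * int (i - j))\<^esub>
        = \<zero>\<^bsub>Hom C X Y (n - 2 * int i)\<^esub>"
      using ob that by (intro Cmp_zero_right coeff_closed[OF f]) auto
    with False that show ?thesis
      by (simp add: Idm_E)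
  qed
  then have "Cmp E X X Y n 0 f (Idm E X) i
      = (\<Oplus>\<^bsub>Hom C X Y (n - 2 * int i)\<^esub>j\<in>{..i}. if i = j then f i else \<zero>\<^bsub>Hom C X Y (n - 2 * int i)\<^esub>)"
    unfolding Cmp_E using f by (simp only: add_0_right) (rule finsum_cong', auto simp: carrier_E)
  also have "\<dots> = f i"
    using f by (intro finsum_singleton) (auto simp: carrier_E)
  finally show "Cmp E X X Y n 0 f (Idm E X) i = f i" .
qed

section \<open>Multiplication by \<epsilon>: injectivity and compatibility with differential and
  composition\<close>

lemma eps_0: "eps C X Y l f 0 = \<zero>\<^bsub>Hom C X Y (l + 2)\<^esub>"
  and eps_Suc: "eps C X Y l f (Suc i) = f i"
  by (simp_all add: eps_def)

text \<open>Multiplication by \<epsilon> shifts the coefficients, so the original series is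
  recovered as the tail. This is what permits cancelling \<epsilon> from the Maurer-Cartan equation
  and from the closedness condition.\<close>

lemma eps_inject: "eps C X Y l f = eps C X Y l g \<longleftrightarrow> f = g"
  by (metis eps_Suc ext)

text \<open>Coefficient \<open>Suc j\<close> in degree \<open>l + 2\<close> lies in the same hom
  module as coefficient \<open>j\<close> in degree \<open>l\<close>, so away from index 0 the shift
  preserves the operations verbatim.\<close>

lemma additive_map_eps:
  assumes ob: "X \<in> Ob C" "Y \<in> Ob C" and "p = l + 2"
  shows "additive_map (Hom E X Y l) (Hom E X Y p) (eps C X Y l)"
  unfolding additive_map_def additive_map_axioms_def
proof (intro conjI allI impI E_abelian_group ob)
  interpret abelian_group "Hom C X Y d" for d
    using ob by (rule Hom_abelian_group)
  fix f assume f: "f \<in> carrier (Hom E X Y l)"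
  then show "eps C X Y l f \<in> carrier (Hom E X Y p)"
    unfolding carrier_E \<open>p = l + 2\<close> by (auto simp: eps_def algebra_simps split: nat.split)
  fix g assume "g \<in> carrier (Hom E X Y l)"
  with f show "eps C X Y l (f \<oplus>\<^bsub>Hom E X Y l\<^esub> g) = eps C X Y l f \<oplus>\<^bsub>Hom E X Y p\<^esub> eps C X Y l g"
    unfolding carrier_E \<open>p = l + 2\<close> add_E
    by (auto simp: eps_def algebra_simps split: nat.split)
qed

lemma Dif_E_closed:
  assumes "X \<in> Ob C" "Y \<in> Ob C" "f \<in> carrier (Hom E X Y l)" "p = l + 1"
  shows "Dif E X Y l f \<in> carrier (Hom E X Y p)"
  using assms Dif_closed[of X Y "f _" "l - 2 * int _"] by (auto simp: carrier_E Dif_E algebra_simps)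

text \<open>The differential acts coefficientwise and hence commutes with the shift; at index 0 it
  has to send zero to zero.\<close>

lemma Dif_eps:
  assumes "X \<in> Ob C" "Y \<in> Ob C" "p = l + 2" "q = l + 1"
  shows "Dif E X Y p (eps C X Y l f) = eps C X Y q (Dif E X Y l f)"
proof
  fix i
  show "Dif E X Y p (eps C X Y l f) i = eps C X Y q (Dif E X Y l f) i"
    using assms additive_map.zero[OF additive_map_Dif[of X Y "l + 2"]]
    by (cases i) (auto simp: Dif_E eps_0 eps_Suc algebra_simps)
qed

text \<open>The summand at \<open>j = 0\<close> vanishes since the shifted series has zero constant
  coefficient; reindexing the others by \<open>j \<mapsto> Suc j\<close> gives the product
  coefficient one index lower.\<close>

lemma Cmp_eps_left:
  assumes ob: "X \<in> Ob C" "Y \<in> Ob C" "Z \<in> Ob C"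
    and g: "g \<in> carrier (Hom E Y Z m)" and f: "f \<in> carrier (Hom E X Y n)"
    and "p = m + 2" "q = m + n"
  shows "Cmp E X Y Z p n (eps C Y Z m g) f = eps C X Z q (Cmp E X Y Z m n g f)"
proof
  fix i
  interpret abelian_group "Hom C X Z d" for d
    using ob(1,3) by (rule Hom_abelian_group)
  have zero: "Cmp C X Y Z (m + 2) (n - 2 * int i) \<zero>\<^bsub>Hom C Y Z (m + 2)\<^esub> (f i)
      = \<zero>\<^bsub>Hom C X Z (m + 2 + n - 2 * int i)\<^esub>" for i
    using ob by (intro Cmp_zero_left coeff_closed[OF f]) auto
  show "Cmp E X Y Z p n (eps C Y Z m g) f i = eps C X Z q (Cmp E X Y Z m n g f) i"
  proof (cases i)
    case 0
    then show ?thesis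
      using zero[of 0] \<open>p = _\<close> \<open>q = _\<close> by (simp add: Cmp_E eps_0 algebra_simps finsum_0 Pi_def del: atMost_0)
  next
    case (Suc i')
    let ?H = "Hom C X Z (m + n - 2 * int i')"
    let ?c = "\<lambda>j. Cmp C X Y Z (m + 2 - 2 * int j) (n - 2 * int (Suc i' - j)) (eps C Y Z m g j) (f (Suc i' - j))"
    have c0: "?c 0 = \<zero>\<^bsub>?H\<^esub>"
      using zero[of "Suc i'"] by (simp add: eps_0 algebra_simps)
    have cS: "?c (Suc j) = Cmp C X Y Z (m - 2 * int j) (n - 2 * int (i' - j)) (g j) (f (i' - j))" for j
      by (simp add: eps_Suc)
    have c_closed: "?c (Suc j) \<in> carrier ?H" if "j \<le> i'" for j
      unfolding cS using ob g f that by (intro Cmp_E_summand_closed) auto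
    \<comment> \<open>The sum is split at its first summand, the one known to vanish.\<close>
    have "finsum ?H ?c {..Suc i'} = finsum ?H (\<lambda>j. ?c (Suc j)) {..i'} \<oplus>\<^bsub>?H\<^esub> ?c 0"
    proof (rule finsum_Suc2)
      show "?c \<in> {..Suc i'} \<rightarrow> carrier ?H"
      proof
        fix j assume "j \<in> {..Suc i'}"
        then show "?c j \<in> carrier ?H"
          using c_closed c0 by (cases j) auto
      qed
    qed
    also have "\<dots> = finsum ?H (\<lambda>j. ?c (Suc j)) {..i'}"
      unfolding c0 using c_closed by (intro r_zero finsum_closed) auto
    finally show ?thesis
      unfolding Suc eps_Suc Cmp_E cS \<open>p = _\<close> \<open>q = _\<close> by (simp add: algebra_simps)
  qed
qed

text \<open>With \<epsilon> in the right factor it is the last summand that vanishes, and the others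
  match without reindexing.\<close>

lemma Cmp_eps_right:
  assumes ob: "X \<in> Ob C" "Y \<in> Ob C" "Z \<in> Ob C"
    and g: "g \<in> carrier (Hom E Y Z m)" and f: "f \<in> carrier (Hom E X Y n)"
    and "p = n + 2" "q = m + n"
  shows "Cmp E X Y Z m p g (eps C X Y n f) = eps C X Z q (Cmp E X Y Z m n g f)"
proof
  fix i
  interpret abelian_group "Hom C X Z d" for d
    using ob(1,3) by (rule Hom_abelian_group)
  have zero: "Cmp C X Y Z (m - 2 * int i) (n + 2) (g i) \<zero>\<^bsub>Hom C X Y (n + 2)\<^esub>
      = \<zero>\<^bsub>Hom C X Z (m + n + 2 - 2 * int i)\<^esub>" for i
    using ob by (intro Cmp_zero_right coeff_closed[OF g]) auto
  show "Cmp E X Y Z m p g (eps C X Y n f) i = eps C X Z q (Cmp E X Y Z m n g f) i"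
  proof (cases i)
    case 0
    then show ?thesis
      using zero[of 0] \<open>p = _\<close> \<open>q = _\<close> by (simp add: Cmp_E eps_0 algebra_simps finsum_0 Pi_def del: atMost_0)
  next
    case (Suc i')
    let ?H = "Hom C X Z (m + n - 2 * int i')"
    let ?c = "\<lambda>j. Cmp C X Y Z (m - 2 * int j) (n + 2 - 2 * int (Suc i' - j)) (g j) (eps C X Y n f (Suc i' - j))"
    let ?d = "\<lambda>j. Cmp C X Y Z (m - 2 * int j) (n - 2 * int (i' - j)) (g j) (f (i' - j))"
    have cS: "?c (Suc i') = \<zero>\<^bsub>?H\<^esub>"
      using zero[of "Suc i'"] by (simp add: eps_0 algebra_simps)
    \<comment> \<open>For \<open>j \<le> i'\<close> one has
      \<open>Suc i' - j = Suc (i' - j)\<close>, so the shift in \<open>eps\<close> is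
      undone.\<close>
    have cd: "?c j = ?d j" if "j \<le> i'" for j
      using that by (simp add: Suc_diff_le eps_Suc algebra_simps)
    have d_closed: "?d j \<in> carrier ?H" if "j \<le> i'" for j
      using ob g f that by (intro Cmp_E_summand_closed) auto
    have "finsum ?H ?c {..Suc i'} = ?c (Suc i') \<oplus>\<^bsub>?H\<^esub> finsum ?H ?c {..i'}"
    proof (rule finsum_Suc)
      show "?c \<in> {..Suc i'} \<rightarrow> carrier ?H"
      proof
        fix j assume "j \<in> {..Suc i'}"
        then show "?c j \<in> carrier ?H"
          using cd d_closed cS by (cases "j = Suc i'") (auto simp: le_Suc_eq)
      qed
    qed
    also have "finsum ?H ?c {..i'} = finsum ?H ?d {..i'}"
      using cd d_closed by (intro finsum_cong') auto
    also have "?c (Suc i') \<oplus>\<^bsub>?H\<^esub> finsum ?H ?d {..i'} = finsum ?H ?d {..i'}"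
      unfolding cS using d_closed by (intro l_zero finsum_closed) auto
    finally show ?thesis
      unfolding Suc eps_Suc Cmp_E \<open>p = _\<close> \<open>q = _\<close> by (simp add: algebra_simps)
  qed
qed

section \<open>Objects and closed morphisms of the curved twisted complexes\<close>

lemma cTw_Ob_iff:
  assumes X: "X \<in> Ob C" and h: "h \<in> carrier (Hom E X X (-1))" and u: "u \<in> carrier (Hom E X X 0)"
  shows "(X, eps C X X (-1) h, eps C X X 0 u) \<in> Ob (cTw E) \<longleftrightarrow>
    Dif E X X (-1) h = u \<ominus>\<^bsub>Hom E X X 0\<^esub> eps C X X (-2) (Cmp E X X X (-1) (-1) h h)"
proof -
  interpret eps: additive_map "Hom E X X l" "Hom E X X (l + 2)" "eps C X X l" for l
    using X by (intro additive_map_eps) auto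
  have hh: "Cmp E X X X (-1) (-1) h h \<in> carrier (Hom E X X (-2))"
    using X h by (intro Cmp_E_closed) auto
  have \<epsilon>hh: "eps C X X (-2) (Cmp E X X X (-1) (-1) h h) \<in> carrier (Hom E X X 0)"
    using eps.closed[OF hh] by simp
  have \<epsilon>h: "eps C X X (-1) h \<in> carrier (Hom E X X 1)"
    using eps.closed[OF h] by simp
  have dh: "Dif E X X (-1) h \<in> carrier (Hom E X X 0)"
    using X h by (intro Dif_E_closed) auto
  \<comment> \<open>Extracting \<epsilon> from the left factor and then from the right one turns the
    square of \<epsilon>h into \<epsilon> applied twice to the square of \<open>h\<close>.\<close>
  have "Cmp E X X X 1 1 (eps C X X (-1) h) (eps C X X (-1) h)
      = eps C X X 0 (Cmp E X X X (-1) 1 h (eps C X X (-1) h))"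
    using X h \<epsilon>h by (intro Cmp_eps_left) auto
  also have "Cmp E X X X (-1) 1 h (eps C X X (-1) h) = eps C X X (-2) (Cmp E X X X (-1) (-1) h h)"
    using X h by (intro Cmp_eps_right) auto
  finally have "Dif E X X 1 (eps C X X (-1) h)
        \<oplus>\<^bsub>Hom E X X 2\<^esub> Cmp E X X X 1 1 (eps C X X (-1) h) (eps C X X (-1) h)
      = eps C X X 0 (Dif E X X (-1) h \<oplus>\<^bsub>Hom E X X 0\<^esub> eps C X X (-2) (Cmp E X X X (-1) (-1) h h))"
    using eps.add[OF dh \<epsilon>hh] X by (simp add: Dif_eps)
  \<comment> \<open>Both sides of the Maurer-Cartan equation are now images under
    \<open>eps\<close>; injectivity cancels one factor, and moving the remaining square across gives
    the formula for the differential of \<open>h\<close>.\<close>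
  then show ?thesis
    using X \<epsilon>h eps.closed[OF u] eps.G.add_eq_iff_eq_minus[OF dh \<epsilon>hh u]
    by (simp add: cTw_def eps_inject)
qed

text \<open>This is the condition that places \<open>f\<close> in the hom modules of
  \<open>cTw\<close>. Once \<epsilon> has left both factors, each side is \<epsilon> times
  \<open>f\<close> minus the composite \<open>f g f\<close>. Exchanging the roles of
  \<open>X\<close> and \<open>Y\<close> gives the condition for \<open>g\<close>.\<close>

lemma curvature_commutes:
  assumes ob: "X \<in> Ob C" "Y \<in> Ob C"
    and f: "f \<in> carrier (Hom E X Y 0)" and g: "g \<in> carrier (Hom E Y X 0)"
  shows "Cmp E X Y Y 2 0 (eps C Y Y 0 (Idm E Y \<ominus>\<^bsub>Hom E Y Y 0\<^esub> Cmp E Y X Y 0 0 f g)) f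
    = Cmp E X X Y 0 2 f (eps C X X 0 (Idm E X \<ominus>\<^bsub>Hom E X X 0\<^esub> Cmp E X Y X 0 0 g f))"
proof -
  interpret l: additive_map "Hom E Y Y 0" "Hom E X Y 0" "\<lambda>u. Cmp E X Y Y 0 0 u f"
    using ob f by (intro additive_map_Cmp_E_left) auto
  interpret r: additive_map "Hom E X X 0" "Hom E X Y 0" "Cmp E X X Y 0 0 f"
    using ob f by (intro additive_map_Cmp_E_right) auto
  have fg: "Cmp E Y X Y 0 0 f g \<in> carrier (Hom E Y Y 0)"
    and gf: "Cmp E X Y X 0 0 g f \<in> carrier (Hom E X X 0)"
    using ob f g by (auto intro: Cmp_E_closed)
  note Id = Idm_E_closed[OF ob(1)] Idm_E_closed[OF ob(2)]
  have "Cmp E X Y Y 0 0 (Idm E Y \<ominus>\<^bsub>Hom E Y Y 0\<^esub> Cmp E Y X Y 0 0 f g) f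
      = f \<ominus>\<^bsub>Hom E X Y 0\<^esub> Cmp E X Y Y 0 0 (Cmp E Y X Y 0 0 f g) f"
    using ob f fg Id by (simp add: l.minus Cmp_E_Idm_left)
  also have "\<dots> = f \<ominus>\<^bsub>Hom E X Y 0\<^esub> Cmp E X X Y 0 0 f (Cmp E X Y X 0 0 g f)"
    using Cmp_E_assoc[OF ob(1,2,1,2) f g f] by simp
  also have "\<dots> = Cmp E X X Y 0 0 f (Idm E X \<ominus>\<^bsub>Hom E X X 0\<^esub> Cmp E X Y X 0 0 g f)"
    using ob f gf Id by (simp add: r.minus Cmp_E_Idm_right)
  finally show ?thesis
    using ob f fg gf Id
    by (simp add: Cmp_eps_left[where m = 0 and q = 0] Cmp_eps_right[where n = 0 and q = 0])
qed

text \<open>The hypothesis on \<open>z\<close> and \<open>w\<close> settles membership in the hom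
  module, leaving the vanishing of the differential. In degree 0 its sign is trivial, and \<epsilon>
  factors out of both correction terms.\<close>

lemma cTw_closed_morphism_iff:
  assumes ob: "X \<in> Ob C" "Y \<in> Ob C"
    and f: "f \<in> carrier (Hom E X Y 0)"
    and h: "h \<in> carrier (Hom E X X (-1))" and k: "k \<in> carrier (Hom E Y Y (-1))"
    and z: "Cmp E X Y Y 2 0 w f = Cmp E X X Y 0 2 f z"
  shows "closed_morphism (cTw E) (X, eps C X X (-1) h, z) (Y, eps C Y Y (-1) k, w) 0 f \<longleftrightarrow>
    Dif E X Y 0 f =
      eps C X Y (-1) (Cmp E X X Y 0 (-1) f h \<ominus>\<^bsub>Hom E X Y (-1)\<^esub> Cmp E X Y Y (-1) 0 k f)"
proof -
  interpret eps: additive_map "Hom E X Y (-1)" "Hom E X Y 1" "eps C X Y (-1)"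
    using ob by (intro additive_map_eps) auto
  have fh: "Cmp E X X Y 0 (-1) f h \<in> carrier (Hom E X Y (-1))"
    and kf: "Cmp E X Y Y (-1) 0 k f \<in> carrier (Hom E X Y (-1))"
    and df: "Dif E X Y 0 f \<in> carrier (Hom E X Y 1)"
    using ob f h k by (auto intro: Cmp_E_closed Dif_E_closed)
  have "Cmp E X Y Y 1 0 (eps C Y Y (-1) k) f = eps C X Y (-1) (Cmp E X Y Y (-1) 0 k f)"
    using ob f k by (intro Cmp_eps_left) auto
  moreover have "Cmp E X X Y 0 1 f (eps C X X (-1) h) = eps C X Y (-1) (Cmp E X X Y 0 (-1) f h)"
    using ob f h by (intro Cmp_eps_right) auto
  ultimately show ?thesis
    using f z eps.H.add_minus_eq_zero_iff[OF df eps.closed[OF kf] eps.closed[OF fh]]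
    by (simp add: closed_morphism_def cTw_def ksign_def eps.minus[OF fh kf])
qed

end

section \<open>Strong homotopy equivalences characterized by curved twisted complexes\<close>

theorem mainTheorem3:
  fixes R :: "('a, 'r) ring_scheme"
    and C :: "('o, 'a, 'm) dgcat"
    and X Y :: 'o
    and f g h k :: "nat \<Rightarrow> 'm"
  assumes "dg_category R C"
    and "X \<in> Ob C" and "Y \<in> Ob C"
    and "f \<in> carrier (Hom (eps_cat C) X Y 0)"
    and "g \<in> carrier (Hom (eps_cat C) Y X 0)"
    and "h \<in> carrier (Hom (eps_cat C) X X (-1))"
    and "k \<in> carrier (Hom (eps_cat C) Y Y (-1))"
  shows "strong_homotopy_equivalence C X Y f g h k \<longleftrightarrow>
    (let E = eps_cat C;
         zX = eps C X X 0 (Idm E X \<ominus>\<^bsub>Hom E X X 0\<^esub> Cmp E X Y X 0 0 g f);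
         zY = eps C Y Y 0 (Idm E Y \<ominus>\<^bsub>Hom E Y Y 0\<^esub> Cmp E Y X Y 0 0 f g);
         X' = (X, eps C X X (-1) h, zX);
         Y' = (Y, eps C Y Y (-1) k, zY)
     in X' \<in> Ob (cTw E) \<and> Y' \<in> Ob (cTw E) \<and>
        closed_morphism (cTw E) X' Y' 0 f \<and> closed_morphism (cTw E) Y' X' 0 g)"
proof -
  interpret dg_category R C by fact
  note ob = assms(2,3) and f = assms(4) and g = assms(5) and h = assms(6) and k = assms(7)
  interpret XX: abelian_group "Hom (eps_cat C) X X 0"
    using ob by (intro E_abelian_group)
  interpret YY: abelian_group "Hom (eps_cat C) Y Y 0"
    using ob by (intro E_abelian_group)
  \<comment> \<open>The curvatures stripped of their factor \<epsilon>; they take the place of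
    \<open>u\<close> in \<open>cTw_Ob_iff\<close>.\<close>
  have p: "Idm (eps_cat C) X \<ominus>\<^bsub>Hom (eps_cat C) X X 0\<^esub> Cmp (eps_cat C) X Y X 0 0 g f
      \<in> carrier (Hom (eps_cat C) X X 0)"
    using ob f g by (intro XX.minus_closed Idm_E_closed Cmp_E_closed) auto
  have q: "Idm (eps_cat C) Y \<ominus>\<^bsub>Hom (eps_cat C) Y Y 0\<^esub> Cmp (eps_cat C) Y X Y 0 0 f g
      \<in> carrier (Hom (eps_cat C) Y Y 0)"
    using ob f g by (intro YY.minus_closed Idm_E_closed Cmp_E_closed) auto
  \<comment> \<open>The four conditions become the four defining equations. Subtraction associates
    to the left, so \<open>u\<close> minus the \<epsilon>-term is literally the right side of the
    equation for \<open>h\<close> or \<open>k\<close>. The conditions for \<open>Y\<close> and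
    \<open>g\<close> arise from those for \<open>X\<close> and \<open>f\<close> by exchanging
    roles.\<close>
  show ?thesis
    unfolding strong_homotopy_equivalence_def Let_def
      cTw_Ob_iff[OF ob(1) h p] cTw_Ob_iff[OF ob(2) k q]
      cTw_closed_morphism_iff[OF ob f h k curvature_commutes[OF ob f g]]
      cTw_closed_morphism_iff[OF ob(2,1) g k h curvature_commutes[OF ob(2,1) g f]]
    using f g h k by blast
qed

end
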